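(* A quaternion $q\in\mathbb H$ can be written in the form $q=u-v$, where $u,v\in\mathbb H$ satisfy $N(u)=N(v)=1$, if and only if $\|q\|\le2$.
   Context: $\mathbb H=\{a+bi+cj+dk\mid a,b,c,d\in\mathbb R\}$, with $i^2=j^2=k^2=ijk=-1$, is the real quaternion division ring. For $\alpha=a+bi+cj+dk$, the norm is $N(\alpha)=a^2+b^2+c^2+d^2$ and the length is $\|\alpha\|=\sqrt{N(\alpha)}$. *)

theory Defs
  imports Complex_Main
begin

datatype quat = Quat (Re_q: real) (Im_i: real) (Im_j: real) (Im_k: real)

lemma quat_eq_iff:
  "p = q \<longleftrightarrow> Re_q p = Re_q q \<and> Im_i p = Im_i q \<and> Im_j p = Im_j q \<and> Im_k p = Im_k q"
  by (cases p; cases q) simp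

instantiation quat :: ab_group_add
begin

definition zero_quat :: quat where
  "0 = Quat 0 0 0 0"

definition plus_quat :: "quat \<Rightarrow> quat \<Rightarrow> quat" where
  "p + q = Quat (Re_q p + Re_q q) (Im_i p + Im_i q) (Im_j p + Im_j q) (Im_k p + Im_k q)"

definition uminus_quat :: "quat \<Rightarrow> quat" where
  "- p = Quat (- Re_q p) (- Im_i p) (- Im_j p) (- Im_k p)"

definition minus_quat :: "quat \<Rightarrow> quat \<Rightarrow> quat" where
  "p - q = Quat (Re_q p - Re_q q) (Im_i p - Im_i q) (Im_j p - Im_j q) (Im_k p - Im_k q)"

instance
  by standard (simp_all add: quat_eq_iff zero_quat_def plus_quat_def uminus_quat_def minus_quat_def)

end

definition quat_N :: "quat \<Rightarrow> real" where
  "quat_N q = (Re_q q)\<^sup>2 + (Im_i q)\<^sup>2 + (Im_j q)\<^sup>2 + (Im_k q)\<^sup>2"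

definition quat_length :: "quat \<Rightarrow> real" where
  "quat_length q = sqrt (quat_N q)"

lemma quat_N_eq_0_iff: "quat_N q = 0 \<longleftrightarrow> q = 0"
  by (simp add: quat_N_def quat_eq_iff zero_quat_def add_nonneg_eq_0_iff)

instantiation quat :: real_div_algebra
begin

definition one_quat :: quat where
  "1 = Quat 1 0 0 0"

definition times_quat :: "quat \<Rightarrow> quat \<Rightarrow> quat" where
  "p * q = Quat
    (Re_q p * Re_q q - Im_i p * Im_i q - Im_j p * Im_j q - Im_k p * Im_k q)
    (Re_q p * Im_i q + Im_i p * Re_q q + Im_j p * Im_k q - Im_k p * Im_j q)
    (Re_q p * Im_j q - Im_i p * Im_k q + Im_j p * Re_q q + Im_k p * Im_i q)
    (Re_q p * Im_k q + Im_i p * Im_j q - Im_j p * Im_i q + Im_k p * Re_q q)"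

definition scaleR_quat :: "real \<Rightarrow> quat \<Rightarrow> quat" where
  "scaleR_quat r q = Quat (r * Re_q q) (r * Im_i q) (r * Im_j q) (r * Im_k q)"

definition inverse_quat :: "quat \<Rightarrow> quat" where
  "inverse q =
    Quat (Re_q q / quat_N q) (- Im_i q / quat_N q) (- Im_j q / quat_N q) (- Im_k q / quat_N q)"

definition divide_quat :: "quat \<Rightarrow> quat \<Rightarrow> quat" where
  "p div q = p * inverse (q::quat)"

instance
proof
  fix p q r :: quat and a b :: real
  note defs = quat_eq_iff zero_quat_def one_quat_def plus_quat_def times_quat_def scaleR_quat_def
  show "p * q * r = p * (q * r)" by (simp add: defs algebra_simps)
  show "1 * p = p" "p * 1 = p" by (simp_all add: defs)
  show "(p + q) * r = p * r + q * r" "p * (q + r) = p * q + p * r"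
    by (simp_all add: defs algebra_simps)
  show "(0::quat) \<noteq> 1" by (simp add: defs)
  show "a *\<^sub>R (p + q) = a *\<^sub>R p + a *\<^sub>R q" "(a + b) *\<^sub>R p = a *\<^sub>R p + b *\<^sub>R p"
    "a *\<^sub>R b *\<^sub>R p = (a * b) *\<^sub>R p" "1 *\<^sub>R p = p"
    "a *\<^sub>R p * q = a *\<^sub>R (p * q)" "p * a *\<^sub>R q = a *\<^sub>R (p * q)"
    by (simp_all add: defs algebra_simps)
  show "inverse (0::quat) = 0" by (simp add: defs inverse_quat_def)
  show "p div q = p * inverse q" by (rule divide_quat_def)
  assume "p \<noteq> 0"
  then have "quat_N p \<noteq> 0" by (simp add: quat_N_eq_0_iff)
  moreover have
    "Re_q p * Re_q p + Im_i p * Im_i p + Im_j p * Im_j p + Im_k p * Im_k p = quat_N p"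
    by (simp add: quat_N_def power2_eq_square)
  ultimately show "inverse p * p = 1" "p * inverse p = 1"
    by (simp_all add: defs inverse_quat_def mult.commute flip: add_divide_distrib diff_divide_distrib)
qed

end

definition quat_i :: quat where "quat_i = Quat 0 1 0 0"
definition quat_j :: quat where "quat_j = Quat 0 0 1 0"
definition quat_k :: quat where "quat_k = Quat 0 0 0 1"

lemma quat_units:
  "quat_i\<^sup>2 = -1" "quat_j\<^sup>2 = -1" "quat_k\<^sup>2 = -1" "quat_i * quat_j * quat_k = -1"
  by (simp_all add: power2_eq_square quat_i_def quat_j_def quat_k_def quat_eq_iff
      times_quat_def one_quat_def uminus_quat_def)

lemma Quat_eq:
  "Quat a b c d = of_real a + of_real b * quat_i + of_real c * quat_j + of_real d * quat_k"
  by (simp add: of_real_def quat_i_def quat_j_def quat_k_def quat_eq_iff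
      plus_quat_def times_quat_def one_quat_def scaleR_quat_def)

end

theory Submission
  imports Defs
begin

text \<open>
  The parallelogram law gives \<open>N(u - v) \<le> 2 N(u) + 2 N(v) = 4\<close>. Conversely, left multiplication
  by \<open>i\<close> is a rotation by a right angle, so for \<open>q \<noteq> 0\<close> the vector \<open>q\<close> is the base of an isosceles
  triangle with sides \<open>(s i \<plusminus> 1/2) q\<close>, and \<open>s\<close> is chosen to make these sides unit vectors.
\<close>

lemma quat_N_nonneg: "0 \<le> quat_N q"
  by (simp add: quat_N_def)

text \<open>Euler's four-square identity.\<close>

lemma quat_N_mult: "quat_N (p * q) = quat_N p * quat_N q"
  by (simp add: quat_N_def times_quat_def power2_eq_square algebra_simps)

lemma quat_N_parallelogram: "quat_N (u + v) + quat_N (u - v) = 2 * quat_N u + 2 * quat_N v"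
  by (simp add: quat_N_def plus_quat_def minus_quat_def power2_eq_square algebra_simps)

lemma quat_length_le_2_iff: "quat_length q \<le> 2 \<longleftrightarrow> quat_N q \<le> 4"
  using real_sqrt_le_iff[of "quat_N q" 4] by (simp add: quat_length_def)

theorem theorem48:
  fixes q :: quat
  shows "(\<exists>u v :: quat. q = u - v \<and> quat_N u = 1 \<and> quat_N v = 1) \<longleftrightarrow> quat_length q \<le> 2"
proof
  assume "\<exists>u v. q = u - v \<and> quat_N u = 1 \<and> quat_N v = 1"
  then obtain u v where "q = u - v" "quat_N u = 1" "quat_N v = 1"
    by blast
  then have "quat_N q \<le> 4"
    using quat_N_parallelogram[of u v] quat_N_nonneg[of "u + v"] by simp
  then show "quat_length q \<le> 2"
    by (simp add: quat_length_le_2_iff)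
next
  assume "quat_length q \<le> 2"
  then have le: "quat_N q \<le> 4"
    by (simp add: quat_length_le_2_iff)
  show "\<exists>u v. q = u - v \<and> quat_N u = 1 \<and> quat_N v = 1"
  proof (cases "q = 0")
    case True
    \<comment> \<open>The general construction divides by \<open>quat_N q\<close>, so
      \<open>q = 0\<close> needs its own pair; any unit minus itself works.\<close>
    have "quat_N 1 = 1"
      by (simp add: quat_N_def one_quat_def)
    with True have "q = 1 - 1 \<and> quat_N 1 = 1 \<and> quat_N 1 = 1"
      by simp
    then show ?thesis
      by blast
  next
    case False
    then have pos: "quat_N q > 0"
      using quat_N_nonneg[of q] quat_N_eq_0_iff[of q] by linarith
    define s where "s = sqrt (1 / quat_N q - 1 / 4)"
    \<comment> \<open>The radicand is nonnegative because \<open>quat_N q\<close> is at most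
      4.\<close>
    have s: "s\<^sup>2 = 1 / quat_N q - 1 / 4"
      using pos le by (simp add: s_def field_simps)
    define u where "u = Quat (1 / 2) s 0 0 * q"
    define v where "v = Quat (- 1 / 2) s 0 0 * q"
    have "Quat (1 / 2) s 0 0 - Quat (- 1 / 2) s 0 0 = 1"
      by (simp add: minus_quat_def one_quat_def)
    then have "q = u - v"
      by (simp add: u_def v_def flip: left_diff_distrib)
    moreover have "quat_N (Quat (1 / 2) s 0 0) = 1 / quat_N q"
      and "quat_N (Quat (- 1 / 2) s 0 0) = 1 / quat_N q"
      \<comment> \<open>Only the norms of explicit quadruples are unfolded, so
        \<open>quat_N q\<close> stays intact and \<open>s\<close> applies:
        \<open>1 / 4 + s\<^sup>2 = 1 / quat_N q\<close>.\<close>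
      by (simp_all add: quat_N_def[of "Quat _ _ _ _"] s power_divide)
    then have "quat_N u = 1" "quat_N v = 1"
      using pos by (simp_all add: u_def v_def quat_N_mult)
    ultimately show ?thesis
      by blast
  qed
qed

end
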